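(* As linear operators on $P(\mathbb{M})$ we have \begin{align*} \rho(a)&=-M_cD_b+\tfrac12 M_eD_bD_d, & L(a)&=M_a,\\ \rho(b)&=M_cD_a-\tfrac12 M_eD_aD_d, & L(b)&=M_b-M_cD_a+\tfrac13 M_eD_aD_d,\\ \rho(c)&=-M_eD_d, & L(c)&=M_c,\\ \rho(d)&=M_eD_c+\tfrac12 M_eD_aD_b, & L(d)&=M_d-M_eD_c-\tfrac13 M_eD_aD_b,\\ \rho(e)&=0, & L(e)&=M_e. \end{align*}
   Context: Let $\mathbb{F}$ be a field of characteristic $\ne 2,3$. $\mathbb{M}$ is the 5-dimensional nilpotent (non-Lie) Malcev algebra over $\mathbb{F}$ with basis $a,b,c,d,e$ and anticommutative product determined by $[a,b]=c$, $[c,d]=e$ (so $[b,a]=-c$, $[d,c]=-e$), all other products of basis elements being $0$. The universal nonassociative enveloping algebra is $U(\mathbb{M})=F(\mathbb{M})/R(\mathbb{M})$, where $F(\mathbb{M})$ is the unital free nonassociative $\mathbb{F}$-algebra on $\{a,b,c,d,e\}$ (with $\mathbb{M}$ viewed as the span of the generators) and $R(\mathbb{M})$ is the two-sided ideal generated by $fg-gf-[f,g]$, $(f,x,y)+(x,f,y)$, $(x,f,y)+(x,y,f)$ for all $f,g\in\mathbb{M}$, $x,y\in F(\mathbb{M})$; here $(x,y,z)=(xy)z-x(yz)$. By a theorem of Pérez-Izquierdo and Shestakov, $\mathbb{M}\to U(\mathbb{M})$ is injective and $U(\mathbb{M})$ has as a basis the left-tapped monomials $x_1(x_2(\cdots(x_{n-1}x_n)\cdots))$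 with $n\ge 0$, $x_1\le\cdots\le x_n$ in the order $a<b<c<d<e$ (the empty monomial being $1$). $P(\mathbb{M})=\mathbb{F}[a,b,c,d,e]$ is the commutative polynomial algebra, and $\phi\colon U(\mathbb{M})\to P(\mathbb{M})$ is the linear isomorphism sending the left-tapped basis monomial $x_1(x_2(\cdots(x_{n-1}x_n)\cdots))$ to $x_1x_2\cdots x_n$. For $x\in U(\mathbb{M})$ the operators $\rho(x),L(x)\in\mathrm{End}_{\mathbb{F}}P(\mathbb{M})$ are $\rho(x)(f)=\phi([\phi^{-1}(f),x])$ and $L(x)(f)=\phi(x\,\phi^{-1}(f))$, where $[y,x]=yx-xy$ in $U(\mathbb{M})$. For $x\in\{a,b,c,d,e\}$, $M_x$ is multiplication by $x$ and $D_x$ is partial differentiation with respect to $x$ on $P(\mathbb{M})$. *)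

theory Defs
  imports Complex_Main "HOL-Library.Poly_Mapping"
begin

datatype gen = Ga | Gb | Gc | Gd | Ge

lemma UNIV_gen: "(UNIV :: gen set) = {Ga, Gb, Gc, Gd, Ge}"
  using gen.exhaust by blast

instance gen :: finite
  by standard (simp add: UNIV_gen)

primrec gen_rank :: "gen \<Rightarrow> nat" where
  "gen_rank Ga = 0"
| "gen_rank Gb = 1"
| "gen_rank Gc = 2"
| "gen_rank Gd = 3"
| "gen_rank Ge = 4"

lemma gen_rank_inject: "gen_rank x = gen_rank y \<longleftrightarrow> x = y"
  by (cases x; cases y) simp_all

instantiation gen :: linorder
begin

definition less_eq_gen :: "gen \<Rightarrow> gen \<Rightarrow> bool" where
  "x \<le> y \<longleftrightarrow> gen_rank x \<le> gen_rank y"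

definition less_gen :: "gen \<Rightarrow> gen \<Rightarrow> bool" where
  "x < y \<longleftrightarrow> gen_rank x < gen_rank y"

instance
  by standard (auto simp: less_eq_gen_def less_gen_def gen_rank_inject)

end

(* The Malcev algebra: a vector is given by its coordinates with respect to the basis a, ..., e;
   the product is the bilinear extension of the multiplication table of the basis. *)

fun basis_bracket :: "gen \<Rightarrow> gen \<Rightarrow> gen \<Rightarrow> 'k::field" where
  "basis_bracket Ga Gb = (\<lambda>z. if z = Gc then 1 else 0)"
| "basis_bracket Gb Ga = (\<lambda>z. if z = Gc then - 1 else 0)"
| "basis_bracket Gc Gd = (\<lambda>z. if z = Ge then 1 else 0)"
| "basis_bracket Gd Gc = (\<lambda>z. if z = Ge then - 1 else 0)"
| "basis_bracket _ _ = (\<lambda>_. 0)"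

definition bracket :: "(gen \<Rightarrow> 'k::field) \<Rightarrow> (gen \<Rightarrow> 'k) \<Rightarrow> gen \<Rightarrow> 'k" where
  "bracket f g = (\<lambda>z. \<Sum>x\<in>UNIV. \<Sum>y\<in>UNIV. f x * g y * basis_bracket x y z)"

(* The free unital nonassociative algebra: finitely supported functions on the free unital magma,
   whose elements are the binary trees together with the empty word None. The library product on
   poly_mapping convolves along an associative addition, so it is not available here. *)

datatype tree = Leaf gen | Node tree tree

fun cat :: "tree option \<Rightarrow> tree option \<Rightarrow> tree option" where
  "cat None v = v"
| "cat u None = u"
| "cat (Some s) (Some t) = Some (Node s t)"

type_synonym 'k free_alg = "tree option \<Rightarrow>\<^sub>0 'k"

definition scale :: "'k::field \<Rightarrow> ('b \<Rightarrow>\<^sub>0 'k) \<Rightarrow> 'b \<Rightarrow>\<^sub>0 'k" where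
  "scale r = Poly_Mapping.map ((*) r)"

definition fmul :: "'k::field free_alg \<Rightarrow> 'k free_alg \<Rightarrow> 'k free_alg" where
  "fmul p q = (\<Sum>u\<in>Poly_Mapping.keys p. \<Sum>v\<in>Poly_Mapping.keys q.
     Poly_Mapping.single (cat u v) (Poly_Mapping.lookup p u * Poly_Mapping.lookup q v))"

definition fassoc :: "'k::field free_alg \<Rightarrow> 'k free_alg \<Rightarrow> 'k free_alg \<Rightarrow> 'k free_alg" where
  "fassoc x y z = fmul (fmul x y) z - fmul x (fmul y z)"

definition femb :: "(gen \<Rightarrow> 'k::field) \<Rightarrow> 'k free_alg" where
  "femb f = (\<Sum>x\<in>UNIV. Poly_Mapping.single (Some (Leaf x)) (f x))"

inductive_set env_ideal :: "'k::field free_alg set" where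
  zero: "0 \<in> env_ideal"
| add: "x \<in> env_ideal \<Longrightarrow> y \<in> env_ideal \<Longrightarrow> x + y \<in> env_ideal"
| scale: "x \<in> env_ideal \<Longrightarrow> scale r x \<in> env_ideal"
| mult_left: "x \<in> env_ideal \<Longrightarrow> fmul y x \<in> env_ideal"
| mult_right: "x \<in> env_ideal \<Longrightarrow> fmul x y \<in> env_ideal"
| commutator: "fmul (femb f) (femb g) - fmul (femb g) (femb f) - femb (bracket f g) \<in> env_ideal"
| nucleus_left: "fassoc (femb f) x y + fassoc x (femb f) y \<in> env_ideal"
| nucleus_right: "fassoc x (femb f) y + fassoc x y (femb f) \<in> env_ideal"

lemma lookup_scale [simp]: "Poly_Mapping.lookup (scale r p) k = r * Poly_Mapping.lookup p k"
  by (simp add: scale_def Poly_Mapping.map.rep_eq when_def)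

lemma vector_space_scale: "vector_space (scale :: 'k::field \<Rightarrow> ('b \<Rightarrow>\<^sub>0 'k) \<Rightarrow> _)"
  by standard (auto intro!: poly_mapping_eqI simp: lookup_add algebra_simps)

lemma fmul_superset:
  assumes "finite A" "Poly_Mapping.keys p \<subseteq> A" "finite B" "Poly_Mapping.keys q \<subseteq> B"
  shows "fmul p q = (\<Sum>u\<in>A. \<Sum>v\<in>B.
    Poly_Mapping.single (cat u v) (Poly_Mapping.lookup p u * Poly_Mapping.lookup q v))"
proof -
  have "fmul p q = (\<Sum>u\<in>Poly_Mapping.keys p. \<Sum>v\<in>B.
    Poly_Mapping.single (cat u v) (Poly_Mapping.lookup p u * Poly_Mapping.lookup q v))"
    unfolding fmul_def using assms
    by (intro sum.cong refl sum.mono_neutral_left) (auto simp: in_keys_iff)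
  also have "\<dots> = (\<Sum>u\<in>A. \<Sum>v\<in>B.
    Poly_Mapping.single (cat u v) (Poly_Mapping.lookup p u * Poly_Mapping.lookup q v))"
    using assms by (intro sum.mono_neutral_left) (auto simp: in_keys_iff)
  finally show ?thesis .
qed

lemma fmul_diff_left: "fmul (p - p') q = fmul p q - fmul p' q"
proof -
  let ?A = "Poly_Mapping.keys p \<union> Poly_Mapping.keys p'"
  let ?B = "Poly_Mapping.keys q"
  have "Poly_Mapping.keys (p - p') \<subseteq> ?A"
    by (auto simp: in_keys_iff lookup_minus)
  then show ?thesis
    by (simp add: fmul_superset[of ?A _ ?B] lookup_minus left_diff_distrib single_diff sum_subtractf)
qed

lemma fmul_diff_right: "fmul p (q - q') = fmul p q - fmul p q'"
proof -
  let ?A = "Poly_Mapping.keys p"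
  let ?B = "Poly_Mapping.keys q \<union> Poly_Mapping.keys q'"
  have "Poly_Mapping.keys (q - q') \<subseteq> ?B"
    by (auto simp: in_keys_iff lookup_minus)
  then show ?thesis
    by (simp add: fmul_superset[of ?A _ ?B] lookup_minus right_diff_distrib single_diff sum_subtractf)
qed

lemma env_ideal_uminus:
  assumes "x \<in> env_ideal"
  shows "- x \<in> env_ideal"
proof -
  have "- x = scale (- 1) x"
    by (rule poly_mapping_eqI) simp
  with env_ideal.scale[OF assms, of "- 1"] show ?thesis by simp
qed

lemma env_ideal_diff: "x \<in> env_ideal \<Longrightarrow> y \<in> env_ideal \<Longrightarrow> x - y \<in> env_ideal"
  using env_ideal.add[OF _ env_ideal_uminus, of x y] by simp

definition env_rel :: "'k::field free_alg \<Rightarrow> 'k free_alg \<Rightarrow> bool" where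
  "env_rel x y \<longleftrightarrow> x - y \<in> env_ideal"

lemma equivp_env_rel: "equivp (env_rel :: 'k::field free_alg \<Rightarrow> 'k free_alg \<Rightarrow> bool)"
proof (rule equivpI)
  show "reflp (env_rel :: 'k free_alg \<Rightarrow> _)"
    by (simp add: reflp_def env_rel_def env_ideal.zero)
  show "symp (env_rel :: 'k free_alg \<Rightarrow> _)"
  proof (rule sympI)
    fix x y :: "'k free_alg"
    assume "env_rel x y"
    then show "env_rel y x"
      using env_ideal_uminus[of "x - y"] by (simp add: env_rel_def)
  qed
  show "transp (env_rel :: 'k free_alg \<Rightarrow> _)"
  proof (rule transpI)
    fix x y z :: "'k free_alg"
    assume "env_rel x y" "env_rel y z"
    then have "(x - y) + (y - z) \<in> env_ideal"
      by (simp only: env_rel_def env_ideal.add)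
    then show "env_rel x z"
      by (simp add: env_rel_def)
  qed
qed

quotient_type (overloaded) 'k env_alg = "'k::field free_alg" / env_rel
  by (rule equivp_env_rel)

instantiation env_alg :: (field) "{ab_group_add, times, one}"
begin

lift_definition zero_env_alg :: "'a env_alg" is 0 .

lift_definition one_env_alg :: "'a env_alg" is "Poly_Mapping.single None 1" .

lift_definition plus_env_alg :: "'a env_alg \<Rightarrow> 'a env_alg \<Rightarrow> 'a env_alg" is "(+)"
  by (auto simp: env_rel_def add_diff_add intro: env_ideal.add)

lift_definition uminus_env_alg :: "'a env_alg \<Rightarrow> 'a env_alg" is uminus
  unfolding env_rel_def using env_ideal_uminus by fastforce

lift_definition minus_env_alg :: "'a env_alg \<Rightarrow> 'a env_alg \<Rightarrow> 'a env_alg" is "(-)"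
proof -
  fix x x' y y' :: "'a free_alg"
  assume "env_rel x x'" "env_rel y y'"
  then have "(x - x') - (y - y') \<in> env_ideal"
    by (simp add: env_rel_def env_ideal_diff)
  then show "env_rel (x - y) (x' - y')"
    by (simp add: env_rel_def algebra_simps)
qed

lift_definition times_env_alg :: "'a env_alg \<Rightarrow> 'a env_alg \<Rightarrow> 'a env_alg" is fmul
proof -
  fix x x' y y' :: "'a free_alg"
  assume "env_rel x x'" "env_rel y y'"
  then have "fmul (x - x') y + fmul x' (y - y') \<in> env_ideal"
    by (auto simp: env_rel_def intro: env_ideal.intros)
  then show "env_rel (fmul x y) (fmul x' y')"
    by (simp add: env_rel_def fmul_diff_left fmul_diff_right)
qed

instance
  by standard (transfer; simp add: env_rel_def env_ideal.zero algebra_simps)+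

end

lift_definition escale :: "'k::field \<Rightarrow> 'k env_alg \<Rightarrow> 'k env_alg" is scale
proof -
  fix r :: 'k and x y :: "'k free_alg"
  assume "env_rel x y"
  moreover have "scale r x - scale r y = scale r (x - y)"
    by (rule poly_mapping_eqI) (simp add: lookup_minus algebra_simps)
  ultimately show "env_rel (scale r x) (scale r y)"
    by (simp add: env_rel_def env_ideal.scale)
qed

lemma vector_space_escale: "vector_space (escale :: 'k::field \<Rightarrow> 'k env_alg \<Rightarrow> 'k env_alg)"
proof -
  interpret F: vector_space "scale :: 'k \<Rightarrow> 'k free_alg \<Rightarrow> 'k free_alg"
    by (rule vector_space_scale)
  show ?thesis
    by standard
      (transfer; simp add: env_rel_def env_ideal.zero F.scale_right_distrib F.scale_left_distrib)+
qed

lift_definition egen :: "gen \<Rightarrow> 'k::field env_alg"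
  is "\<lambda>x. Poly_Mapping.single (Some (Leaf x)) 1" .

fun left_tapped :: "gen list \<Rightarrow> 'k::field env_alg" where
  "left_tapped [] = 1"
| "left_tapped [x] = egen x"
| "left_tapped (x # y # zs) = egen x * left_tapped (y # zs)"

(* The commutative polynomial algebra: monomials are exponent vectors, and here the product is
   the one of the library. *)

type_synonym 'k pol = "(gen \<Rightarrow>\<^sub>0 nat) \<Rightarrow>\<^sub>0 'k"

definition pvar :: "gen \<Rightarrow> 'k::field pol" where
  "pvar x = Poly_Mapping.single (Poly_Mapping.single x 1) 1"

definition mulop :: "gen \<Rightarrow> 'k::field pol \<Rightarrow> 'k pol" where
  "mulop x f = pvar x * f"

(* If x does not occur in m, the truncated subtraction is harmless: the coefficient is then 0. *)

definition dop :: "gen \<Rightarrow> 'k::field pol \<Rightarrow> 'k pol" where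
  "dop x f = (\<Sum>m\<in>Poly_Mapping.keys f.
     Poly_Mapping.single (m - Poly_Mapping.single x 1)
       (of_nat (Poly_Mapping.lookup m x) * Poly_Mapping.lookup f m))"

(* The linear isomorphism from the enveloping algebra to the polynomials determined by sorted
   left-tapped monomials; it exists, and is unique, since these form a basis
   (Perez-Izquierdo and Shestakov). *)

definition is_pbw_iso :: "('k::field env_alg \<Rightarrow> 'k pol) \<Rightarrow> bool" where
  "is_pbw_iso \<phi> \<longleftrightarrow> Vector_Spaces.linear escale scale \<phi> \<and> bij \<phi> \<and>
     (\<forall>xs. sorted xs \<longrightarrow> \<phi> (left_tapped xs) = prod_list (map pvar xs))"

definition rho :: "('k::field env_alg \<Rightarrow> 'k pol) \<Rightarrow> 'k env_alg \<Rightarrow> 'k pol \<Rightarrow> 'k pol" where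
  "rho \<phi> x f = \<phi> (inv \<phi> f * x - x * inv \<phi> f)"

definition lmul :: "('k::field env_alg \<Rightarrow> 'k pol) \<Rightarrow> 'k env_alg \<Rightarrow> 'k pol \<Rightarrow> 'k pol" where
  "lmul \<phi> x f = \<phi> (x * inv \<phi> f)"

end

theory Submission
  imports Defs
begin

text \<open>Let \<open>f, g\<close> be generators and \<open>x\<close> any element of the enveloping algebra. Generators lie in the
  generalized alternative nucleus, so the associator \<open>A = (x, f, g)\<close> is alternating under permutations
  of its entries, and expanding products gives
  \<open>[[x, f], g] - [[x, g], f] - [x, [f, g]] = 6 A\<close>,
  \<open>[f x, g] = [f, g] x + f [x, g] - 3 A\<close> and \<open>g (f x) = f (g x) - [f, g] x + 2 A\<close>.
  Through \<open>\<phi>\<close> these become recursions for \<open>\<rho>(g)\<close> and \<open>L(g)\<close> on \<open>f q\<close>, where \<open>f\<close> is the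
  least variable of the monomial \<open>f q\<close>. Together with \<open>L(f) = M\<^sub>f\<close> on polynomials in the variables
  \<open>\<ge> f\<close> they determine all the operators by induction on the degree, and the claimed differential
  operators satisfy the same recursions.\<close>

interpretation pol: vector_space "scale :: 'k::field \<Rightarrow> ('b \<Rightarrow>\<^sub>0 'k) \<Rightarrow> _"
  by (rule vector_space_scale)

interpretation env: vector_space "escale :: 'k::field \<Rightarrow> 'k env_alg \<Rightarrow> _"
  by (rule vector_space_escale)

subsection \<open>Multiplication and differentiation on polynomials\<close>

lemma scale_conv_mult: "scale r p = Poly_Mapping.single 0 r * (p :: 'k::field pol)"
  unfolding scale_def by (rule mult_map_scale_conv_mult)

lemma mult_scale_right: "p * scale r q = scale r (p * (q :: 'k::field pol))"
  by (simp add: scale_conv_mult mult.left_commute)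

lemma scale_single: "scale r (Poly_Mapping.single m c) = Poly_Mapping.single m (r * c)"
  by (rule poly_mapping_eqI) (simp add: lookup_single when_def)

lemma pol_sum_monomials:
  "p = (\<Sum>m\<in>Poly_Mapping.keys p. scale (Poly_Mapping.lookup p m) (Poly_Mapping.single m (1::'k::field)))"
proof (rule poly_mapping_eqI)
  fix k
  have "(\<Sum>m\<in>Poly_Mapping.keys p. Poly_Mapping.lookup p m * (1 when m = k))
      = (\<Sum>m\<in>Poly_Mapping.keys p. if m = k then Poly_Mapping.lookup p m else 0)"
    by (rule sum.cong) (auto simp: when_def)
  then show "Poly_Mapping.lookup p k = Poly_Mapping.lookup (\<Sum>m\<in>Poly_Mapping.keys p.
      scale (Poly_Mapping.lookup p m) (Poly_Mapping.single m 1)) k"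
    by (simp add: lookup_sum lookup_single in_keys_iff)
qed

lemma linear_eq_on_monomials:
  fixes S T :: "('b \<Rightarrow>\<^sub>0 'k::field) \<Rightarrow> 'c \<Rightarrow>\<^sub>0 'k"
  assumes S: "Vector_Spaces.linear scale scale S" and T: "Vector_Spaces.linear scale scale T"
    and eq: "\<And>m. m \<in> Poly_Mapping.keys p \<Longrightarrow> S (Poly_Mapping.single m 1) = T (Poly_Mapping.single m 1)"
  shows "S p = T p"
proof -
  interpret S: Vector_Spaces.linear scale scale S by (rule S)
  interpret T: Vector_Spaces.linear scale scale T by (rule T)
  show ?thesis
    by (subst (1 2) pol_sum_monomials) (simp add: S.sum T.sum S.scale T.scale eq)
qed

lemma dop_superset:
  assumes "finite A" "Poly_Mapping.keys f \<subseteq> A"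
  shows "dop x f = (\<Sum>m\<in>A. Poly_Mapping.single (m - Poly_Mapping.single x 1)
    (of_nat (Poly_Mapping.lookup m x) * Poly_Mapping.lookup f m))"
  unfolding dop_def using assms
  by (intro sum.mono_neutral_left) (auto simp: in_keys_iff)

lemma linear_dop: "Vector_Spaces.linear scale scale (dop x :: 'k::field pol \<Rightarrow> _)"
  unfolding Vector_Spaces.linear_iff
proof (intro conjI allI vector_space_scale)
  fix p q :: "'k pol" and r :: 'k
  let ?A = "Poly_Mapping.keys p \<union> Poly_Mapping.keys q"
  show "dop x (p + q) = dop x p + dop x q"
    using keys_add[of p q]
    by (simp add: dop_superset[of ?A] lookup_add single_add sum.distrib distrib_left)
  have "Poly_Mapping.keys (scale r p) \<subseteq> Poly_Mapping.keys p"
    by (auto simp: in_keys_iff)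
  then show "dop x (scale r p) = scale r (dop x p)"
    by (simp add: dop_superset[of "Poly_Mapping.keys p"] pol.scale_sum_right scale_single
        mult.left_commute)
qed

interpretation dop: Vector_Spaces.linear scale scale "dop x :: 'k::field pol \<Rightarrow> _" for x
  by (rule linear_dop)

lemma dop_single:
  "dop x (Poly_Mapping.single m c) =
    Poly_Mapping.single (m - Poly_Mapping.single x 1) (of_nat (Poly_Mapping.lookup m x) * (c::'k::field))"
  by (subst dop_superset[of "{m}"]) auto

lemma dop_single_plus:
  "dop x (Poly_Mapping.single (Poly_Mapping.single x 1 + m) c) =
    Poly_Mapping.single m ((1 + of_nat (Poly_Mapping.lookup m x)) * (c::'k::field))"
  by (simp add: dop_single lookup_add)

lemma dop_commute: "dop x (dop y p) = dop y (dop x (p :: 'k::field pol))"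
proof -
  have "dop x (dop y (Poly_Mapping.single m 1)) = dop y (dop x (Poly_Mapping.single m (1::'k)))" for m
    by (cases "x = y") (simp_all add: dop_single diff_diff_eq add.commute lookup_minus
        lookup_single_not_eq mult.commute)
  moreover have "Vector_Spaces.linear scale scale (\<lambda>p :: 'k pol. dop x (dop y p))" for x y
    by (simp add: Vector_Spaces.linear_iff vector_space_scale dop.add dop.scale)
  ultimately show ?thesis
    using linear_eq_on_monomials by blast
qed

lemma dop_dop_eq_0: "dop x p = 0 \<Longrightarrow> dop x (dop y (p :: 'k::field pol)) = 0"
  by (simp add: dop_commute[of x y])

lemma dop_pvar_mult:
  "dop x (pvar y * p) = (if x = y then p else 0) + pvar y * dop x (p :: 'k::field pol)"
proof -
  have "dop x (pvar y * Poly_Mapping.single m 1)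
      = (if x = y then Poly_Mapping.single m 1 else 0) + pvar y * dop x (Poly_Mapping.single m (1::'k))" for m
  proof (cases "Poly_Mapping.lookup m x = 0")
    case True
    then show ?thesis
      by (simp add: pvar_def mult_single dop_single lookup_add lookup_single when_def)
  next
    case False
    define m' where "m' = m - Poly_Mapping.single x 1"
    have m: "m = Poly_Mapping.single x 1 + m'"
      using False by (intro poly_mapping_eqI) (auto simp: m'_def lookup_add lookup_minus lookup_single when_def)
    have "dop x (pvar y * Poly_Mapping.single m 1)
        = dop x (Poly_Mapping.single (Poly_Mapping.single x 1 + (Poly_Mapping.single y 1 + m')) (1::'k))"
      by (simp add: pvar_def mult_single m add.left_commute)
    also have "\<dots> = Poly_Mapping.single (Poly_Mapping.single y 1 + m')
        ((if x = y then 1 else 0) + (1 + of_nat (Poly_Mapping.lookup m' x)))"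
      unfolding dop_single_plus by (simp add: lookup_add lookup_single when_def)
    also have "\<dots> = (if x = y then Poly_Mapping.single m 1 else 0)
        + pvar y * Poly_Mapping.single m' (1 + of_nat (Poly_Mapping.lookup m' x))"
      by (simp add: pvar_def mult_single m single_add distrib_left)
    finally show ?thesis
      unfolding m dop_single_plus by simp
  qed
  moreover have "Vector_Spaces.linear scale scale (\<lambda>p :: 'k pol. dop x (pvar y * p))"
    by (simp add: Vector_Spaces.linear_iff vector_space_scale dop.add dop.scale mult_scale_right distrib_left)
  moreover have "Vector_Spaces.linear scale scale
      (\<lambda>p :: 'k pol. (if x = y then p else 0) + pvar y * dop x p)"
    by (simp add: Vector_Spaces.linear_iff vector_space_scale dop.add dop.scale mult_scale_right
        pol.scale_right_distrib distrib_left add_ac)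
  ultimately show ?thesis
    using linear_eq_on_monomials by blast
qed

lemma keys_mulop: "Poly_Mapping.keys (mulop x p) \<subseteq> (\<lambda>m. Poly_Mapping.single x 1 + m) ` Poly_Mapping.keys p"
  using keys_mult[of "pvar x" p] by (auto simp: mulop_def pvar_def)

lemma keys_dop:
  "Poly_Mapping.keys (dop x p) \<subseteq> {m. Poly_Mapping.single x 1 + m \<in> Poly_Mapping.keys p}"
proof
  fix k assume "k \<in> Poly_Mapping.keys (dop x p)"
  then obtain m where m: "m \<in> Poly_Mapping.keys p" and k: "k = m - Poly_Mapping.single x 1"
    and nz: "Poly_Mapping.lookup m x \<noteq> 0"
    unfolding dop_def using keys_sum[of _ "Poly_Mapping.keys p"] by (fastforce split: if_splits)
  have "Poly_Mapping.single x 1 + k = m"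
    using nz by (intro poly_mapping_eqI) (auto simp: k lookup_add lookup_minus lookup_single when_def)
  with m show "k \<in> {m. Poly_Mapping.single x 1 + m \<in> Poly_Mapping.keys p}" by simp
qed


subsection \<open>The differential operators of the theorem\<close>

primrec rop :: "gen \<Rightarrow> 'k::field pol \<Rightarrow> 'k pol" where
  "rop Ga f = - mulop Gc (dop Gb f) + scale (1/2) (mulop Ge (dop Gb (dop Gd f)))"
| "rop Gb f = mulop Gc (dop Ga f) - scale (1/2) (mulop Ge (dop Ga (dop Gd f)))"
| "rop Gc f = - mulop Ge (dop Gd f)"
| "rop Gd f = mulop Ge (dop Gc f) + scale (1/2) (mulop Ge (dop Ga (dop Gb f)))"
| "rop Ge f = 0"

primrec lop :: "gen \<Rightarrow> 'k::field pol \<Rightarrow> 'k pol" where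
  "lop Ga f = mulop Ga f"
| "lop Gb f = mulop Gb f - mulop Gc (dop Ga f) + scale (1/3) (mulop Ge (dop Ga (dop Gd f)))"
| "lop Gc f = mulop Gc f"
| "lop Gd f = mulop Gd f - mulop Ge (dop Gc f) - scale (1/3) (mulop Ge (dop Ga (dop Gb f)))"
| "lop Ge f = mulop Ge f"

definition bracket_op :: "(gen \<Rightarrow> 'k::field pol \<Rightarrow> 'k pol) \<Rightarrow> gen \<Rightarrow> gen \<Rightarrow> 'k pol \<Rightarrow> 'k pol" where
  "bracket_op T f g p = (\<Sum>h\<in>UNIV. scale (basis_bracket f g h) (T h p))"

text \<open>Six times the associator \<open>(x, f, g)\<close>, expressed through the commutators with \<open>f\<close> and \<open>g\<close>.\<close>

definition sixfold_associator_op :: "(gen \<Rightarrow> 'k::field pol \<Rightarrow> 'k pol) \<Rightarrow> gen \<Rightarrow> gen \<Rightarrow> 'k pol \<Rightarrow> 'k pol" where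
  "sixfold_associator_op R f g p = R g (R f p) - R f (R g p) - bracket_op R f g p"

lemma linear_mulop: "Vector_Spaces.linear scale scale (mulop x :: 'k::field pol \<Rightarrow> _)"
  by (simp add: Vector_Spaces.linear_iff vector_space_scale mulop_def mult_scale_right distrib_left)

interpretation mulop: Vector_Spaces.linear scale scale "mulop x :: 'k::field pol \<Rightarrow> _" for x
  by (rule linear_mulop)

lemma linear_rop: "Vector_Spaces.linear scale scale (rop x :: 'k::field pol \<Rightarrow> _)"
  by (cases x) (simp_all add: Vector_Spaces.linear_iff vector_space_scale dop.add dop.scale mulop.add
      mulop.scale pol.scale_right_distrib pol.scale_right_diff_distrib mult.commute)

lemma linear_lop: "Vector_Spaces.linear scale scale (lop x :: 'k::field pol \<Rightarrow> _)"
  by (cases x) (simp_all add: Vector_Spaces.linear_iff vector_space_scale dop.add dop.scale mulop.add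
      mulop.scale pol.scale_right_distrib pol.scale_right_diff_distrib mult.commute)

lemma dop_mulop: "dop x (mulop y p) = (if x = y then p else 0) + mulop y (dop x p)"
  by (simp add: mulop_def dop_pvar_mult)

lemma mulop_commute: "mulop x (mulop y p) = mulop y (mulop x p)"
  by (simp add: mulop_def mult.left_commute)

lemmas operator_simps =
  bracket_op_def sixfold_associator_op_def UNIV_gen less_gen_def dop_mulop
  dop.add dop.diff dop.neg dop.scale mulop.add mulop.diff mulop.neg mulop.scale
  pol.scale_right_distrib pol.scale_right_diff_distrib

lemma rop_mulop:
  assumes "\<And>y. y < f \<Longrightarrow> dop y p = 0"
  shows "rop g (mulop f p) =
    bracket_op lop f g p + lop f (rop g p) - scale (1/2) (sixfold_associator_op rop f g p)"
  using assms[of Ga] assms[of Gb] assms[of Gc] assms[of Gd]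
  by (cases f; cases g)
    (simp_all add: operator_simps dop_commute dop_dop_eq_0 mulop_commute mult.commute)

lemma lop_mulop:
  assumes "\<And>y. y < f \<Longrightarrow> dop y p = 0"
  shows "f < g \<Longrightarrow> lop g (mulop f p) =
    mulop f (lop g p) - bracket_op lop f g p + scale (1/3) (sixfold_associator_op rop f g p)"
  using assms[of Ga] assms[of Gb] assms[of Gc] assms[of Gd]
  by (cases f; cases g)
    (simp_all add: operator_simps dop_commute dop_dop_eq_0 mulop_commute mult.commute)

lemma lop_least:
  assumes "\<And>y. y < g \<Longrightarrow> dop y p = 0"
  shows "lop g p = mulop g p"
  using assms[of Ga] assms[of Gb] assms[of Gc] assms[of Gd]
  by (cases g) (simp_all add: less_gen_def dop_dop_eq_0)


subsection \<open>Supports\<close>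

lemma keys_subset_add:
  "Poly_Mapping.keys p \<subseteq> K \<Longrightarrow> Poly_Mapping.keys q \<subseteq> K \<Longrightarrow> Poly_Mapping.keys (p + q) \<subseteq> K"
  using keys_add[of p q] by blast

lemma keys_subset_uminus:
  "Poly_Mapping.keys p \<subseteq> K \<Longrightarrow> Poly_Mapping.keys (- p :: 'b \<Rightarrow>\<^sub>0 'k::field) \<subseteq> K"
  by (auto simp: in_keys_iff)

lemma keys_subset_diff:
  "Poly_Mapping.keys p \<subseteq> K \<Longrightarrow> Poly_Mapping.keys q \<subseteq> K \<Longrightarrow>
    Poly_Mapping.keys (p - q :: 'b \<Rightarrow>\<^sub>0 'k::field) \<subseteq> K"
  using keys_subset_add[of p K "- q"] keys_subset_uminus[of q K] by simp

lemma keys_subset_scale: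
  "Poly_Mapping.keys p \<subseteq> K \<Longrightarrow> Poly_Mapping.keys (scale r p) \<subseteq> K"
  by (auto simp: in_keys_iff)

lemmas keys_subset_intros =
  keys_subset_add keys_subset_uminus keys_subset_diff keys_subset_scale

definition monos_ge :: "gen \<Rightarrow> (gen \<Rightarrow>\<^sub>0 nat) set" where
  "monos_ge f = {m. \<forall>y<f. Poly_Mapping.lookup m y = 0}"

definition mdeg :: "(gen \<Rightarrow>\<^sub>0 nat) \<Rightarrow> nat" where
  "mdeg m = (\<Sum>x\<in>UNIV. Poly_Mapping.lookup m x)"

lemma mdeg_single_plus: "mdeg (Poly_Mapping.single x 1 + m) = Suc (mdeg m)"
  by (cases x) (simp_all add: mdeg_def UNIV_gen lookup_add lookup_single)

lemma monos_ge_single_plus: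
  "Poly_Mapping.single x 1 + m \<in> monos_ge f \<longleftrightarrow> f \<le> x \<and> m \<in> monos_ge f"
  by (auto simp: monos_ge_def lookup_add lookup_single when_def not_le[symmetric])

lemma keys_mulop_monos_ge:
  "Poly_Mapping.keys p \<subseteq> monos_ge f \<Longrightarrow> f \<le> x \<Longrightarrow> Poly_Mapping.keys (mulop x p) \<subseteq> monos_ge f"
  using keys_mulop[of x p] monos_ge_single_plus[of x _ f] by blast

lemma keys_dop_monos_ge:
  "Poly_Mapping.keys p \<subseteq> monos_ge f \<Longrightarrow> Poly_Mapping.keys (dop x p) \<subseteq> monos_ge f"
  using keys_dop[of x p] monos_ge_single_plus[of x _ f] by blast

lemma keys_lop_monos_ge:
  assumes "Poly_Mapping.keys p \<subseteq> monos_ge f" and "f \<le> g"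
  shows "Poly_Mapping.keys (lop g p) \<subseteq> monos_ge f"
  using assms
  by (cases g; simp only: lop.simps)
    (intro keys_subset_intros keys_mulop_monos_ge keys_dop_monos_ge; simp add: less_eq_gen_def)+

lemma dop_eq_0_monos_ge:
  "Poly_Mapping.keys p \<subseteq> monos_ge f \<Longrightarrow> y < f \<Longrightarrow> dop y p = 0"
  by (auto simp: dop_def monos_ge_def intro!: sum.neutral)

lemma keys_mulop_dop_mdeg:
  assumes "Poly_Mapping.keys p \<subseteq> {m. mdeg m \<le> n}"
  shows "Poly_Mapping.keys (mulop x (dop y p)) \<subseteq> {m. mdeg m \<le> n}"
proof
  fix k assume "k \<in> Poly_Mapping.keys (mulop x (dop y p))"
  then obtain m where "k = Poly_Mapping.single x 1 + m" "m \<in> Poly_Mapping.keys (dop y p)"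
    using keys_mulop by blast
  moreover from this have "mdeg (Poly_Mapping.single y 1 + m) \<le> n"
    using assms keys_dop by blast
  ultimately show "k \<in> {m. mdeg m \<le> n}"
    by (simp only: mdeg_single_plus mem_Collect_eq)
qed

lemma keys_dop_mdeg:
  assumes "Poly_Mapping.keys p \<subseteq> {m. mdeg m \<le> n}"
  shows "Poly_Mapping.keys (dop y p) \<subseteq> {m. mdeg m \<le> n}"
proof
  fix k assume "k \<in> Poly_Mapping.keys (dop y p)"
  then have "mdeg (Poly_Mapping.single y 1 + k) \<le> n"
    using assms keys_dop by blast
  then show "k \<in> {m. mdeg m \<le> n}"
    by (simp only: mdeg_single_plus mem_Collect_eq)
qed

lemma keys_rop_mdeg:
  "Poly_Mapping.keys p \<subseteq> {m. mdeg m \<le> n} \<Longrightarrow> Poly_Mapping.keys (rop g p) \<subseteq> {m. mdeg m \<le> n}"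
  by (cases g; simp only: rop.simps keys_zero empty_subsetI)
    (intro keys_subset_intros keys_mulop_dop_mdeg keys_dop_mdeg; simp)+

lemma mono_cases:
  obtains "m = 0"
  | f m' where "m = Poly_Mapping.single f 1 + m'" "m' \<in> monos_ge f"
proof (cases "m = 0")
  case False
  let ?K = "Poly_Mapping.keys m"
  define f where "f = Min ?K"
  have "?K \<noteq> {}" using False by (auto simp: poly_mapping_eq_iff in_keys_iff fun_eq_iff)
  then have f: "f \<in> ?K" "\<And>y. y < f \<Longrightarrow> y \<notin> ?K"
    by (auto simp: f_def dest: Min_le[OF finite_keys])
  define m' where "m' = m - Poly_Mapping.single f 1"
  have m: "m = Poly_Mapping.single f 1 + m'"
    using f(1) by (intro poly_mapping_eqI)
      (auto simp: m'_def lookup_add lookup_minus lookup_single when_def in_keys_iff)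
  have "m \<in> monos_ge f"
    using f(2) by (auto simp: monos_ge_def in_keys_iff)
  then have "m' \<in> monos_ge f"
    unfolding m by (simp only: monos_ge_single_plus)
  with m show ?thesis by (rule that(2))
qed (use that in blast)

lemma operators_determined:
  fixes R L :: "gen \<Rightarrow> 'k::field pol \<Rightarrow> 'k pol"
  assumes linR: "\<And>g. Vector_Spaces.linear scale scale (R g)"
    and linL: "\<And>g. Vector_Spaces.linear scale scale (L g)"
    and RL: "\<And>f g p. R g (L f p) =
      bracket_op L f g p + L f (R g p) - scale (1/2) (sixfold_associator_op R f g p)"
    and LL: "\<And>f g p. L g (L f p) =
      L f (L g p) - bracket_op L f g p + scale (1/3) (sixfold_associator_op R f g p)"
    and R_one: "\<And>g. R g 1 = 0"
    and L_least: "\<And>g m. m \<in> monos_ge g \<Longrightarrow>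
      L g (Poly_Mapping.single m 1) = mulop g (Poly_Mapping.single m 1)"
  shows "R g p = rop g p \<and> L g p = lop g p"
proof -
  have L_mulop: "L f p = mulop f p" if "Poly_Mapping.keys p \<subseteq> monos_ge f" for f p
    using that L_least by (blast intro: linear_eq_on_monomials[OF linL linear_mulop])
  have lop_mulop': "lop f p = mulop f p" if "Poly_Mapping.keys p \<subseteq> monos_ge f"
    for f and p :: "'k pol"
    using that by (intro lop_least dop_eq_0_monos_ge)
  have mono: "R g (Poly_Mapping.single m 1) = rop g (Poly_Mapping.single m 1) \<and>
      L g (Poly_Mapping.single m 1) = lop g (Poly_Mapping.single m 1)" if "mdeg m \<le> n" for n m g
    using that
  proof (induction n arbitrary: m g rule: less_induct)
    case (less n)
    show ?case
    proof (cases m rule: mono_cases)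
      case 1
      have "rop g (Poly_Mapping.single 0 1) = 0"
        by (cases g) (simp_all add: dop_single del: single_one)
      moreover have "L g (Poly_Mapping.single m 1) = lop g (Poly_Mapping.single m 1)"
        using L_mulop[of "Poly_Mapping.single m 1" g] lop_mulop'[of "Poly_Mapping.single m 1" g]
        by (simp add: 1 monos_ge_def)
      ultimately show ?thesis
        using R_one by (simp add: 1)
    next
      case (2 f m')
      define q where "q = Poly_Mapping.single m' (1::'k)"
      let ?B = "{k. mdeg k \<le> mdeg m'}"
      have mq: "Poly_Mapping.single m 1 = mulop f q"
        by (simp add: q_def mulop_def pvar_def mult_single 2)
      have B: "Poly_Mapping.keys q \<subseteq> ?B" and V: "Poly_Mapping.keys q \<subseteq> monos_ge f"
        using 2 by (auto simp: q_def)
      have deg: "mdeg m' < n"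
        using less.prems by (simp only: 2 mdeg_single_plus)
      have R: "R h p = rop h p" and L: "L h p = lop h p" if "Poly_Mapping.keys p \<subseteq> ?B" for h p
        using that less.IH[OF deg] linear_eq_on_monomials[OF linR linear_rop]
          linear_eq_on_monomials[OF linL linear_lop] by blast+
      have A: "sixfold_associator_op R f h q = sixfold_associator_op rop f h q" for h
        by (simp add: sixfold_associator_op_def bracket_op_def R B keys_rop_mdeg)
      have br: "bracket_op L f h q = bracket_op lop f h q" for h
        by (simp add: bracket_op_def L B)
      have Lq: "mulop f q = L f q"
        using L_mulop[OF V] by simp
      have zero: "dop y q = 0" if "y < f" for y
        using dop_eq_0_monos_ge[OF V that] .
      have "R g (mulop f q) = R g (L f q)"
        by (simp only: Lq)
      also have "\<dots> = bracket_op lop f g q + lop f (rop g q)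
          - scale (1/2) (sixfold_associator_op rop f g q)"
        by (simp only: RL A br R[OF B] L[OF keys_rop_mdeg[OF B]])
      also have "\<dots> = rop g (mulop f q)"
        by (rule rop_mulop[OF zero, symmetric])
      finally have "R g (mulop f q) = rop g (mulop f q)" .
      moreover have "L g (mulop f q) = lop g (mulop f q)"
      proof (cases "f < g")
        case True
        then have V': "Poly_Mapping.keys (lop g q) \<subseteq> monos_ge f"
          using V by (intro keys_lop_monos_ge) simp_all
        have "L g (mulop f q) = L g (L f q)"
          by (simp only: Lq)
        also have "\<dots> = mulop f (lop g q) - bracket_op lop f g q
            + scale (1/3) (sixfold_associator_op rop f g q)"
          unfolding LL[of g f q] by (simp only: A br L[OF B] L_mulop[OF V'])
        also have "\<dots> = lop g (mulop f q)"
          by (rule lop_mulop[OF zero True, symmetric])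
        finally show ?thesis .
      next
        case False
        have "monos_ge f \<subseteq> monos_ge g"
          using False by (auto simp: monos_ge_def)
        with V have "Poly_Mapping.keys (mulop f q) \<subseteq> monos_ge g"
          using False by (intro keys_mulop_monos_ge) auto
        then show ?thesis
          using L_mulop lop_mulop' by simp
      qed
      ultimately show ?thesis by (simp only: mq)
    qed
  qed
  show ?thesis
    using mono[OF order.refl] linear_eq_on_monomials[OF linR linear_rop]
      linear_eq_on_monomials[OF linL linear_lop] by blast
qed


subsection \<open>The enveloping algebra\<close>

lemma fmul_scale_left: "fmul (scale r p) q = scale r (fmul p q)"
proof -
  have "Poly_Mapping.keys (scale r p) \<subseteq> Poly_Mapping.keys p"
    by (auto simp: in_keys_iff)
  then show ?thesis
    by (simp add: fmul_superset[of "Poly_Mapping.keys p" _ "Poly_Mapping.keys q"]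
        pol.scale_sum_right scale_single mult.assoc)
qed

lemma fmul_scale_right: "fmul p (scale r q) = scale r (fmul p q)"
proof -
  have "Poly_Mapping.keys (scale r q) \<subseteq> Poly_Mapping.keys q"
    by (auto simp: in_keys_iff)
  then show ?thesis
    by (simp add: fmul_superset[of "Poly_Mapping.keys p" _ "Poly_Mapping.keys q"]
        pol.scale_sum_right scale_single mult.left_commute)
qed

lemma sum_single_keys: "(\<Sum>k\<in>Poly_Mapping.keys p. Poly_Mapping.single k (Poly_Mapping.lookup p k)) = p"
  by (rule poly_mapping_eqI) (simp add: lookup_sum lookup_single when_def in_keys_iff sum.delta')

lemma cat_None_right: "cat u None = u"
  by (cases u) simp_all

lemma fmul_one_left: "fmul (Poly_Mapping.single None 1) p = p"
  by (simp add: fmul_def sum_single_keys)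

lemma fmul_one_right: "fmul p (Poly_Mapping.single None 1) = p"
  by (simp add: fmul_def cat_None_right sum_single_keys)

context
  fixes x y z :: "'k::field env_alg"
begin

lemma env_one_left: "1 * x = x"
  by transfer (simp add: fmul_one_left env_rel_def env_ideal.zero)

lemma env_one_right: "x * 1 = x"
  by transfer (simp add: fmul_one_right env_rel_def env_ideal.zero)

lemma env_diff_mult: "(x - y) * z = x * z - y * z"
  by transfer (simp add: fmul_diff_left env_rel_def env_ideal.zero)

lemma env_mult_diff: "x * (y - z) = x * y - x * z"
  by transfer (simp add: fmul_diff_right env_rel_def env_ideal.zero)

lemma env_scale_mult: "escale r x * y = escale r (x * y)"
  by transfer (simp add: fmul_scale_left env_rel_def env_ideal.zero)

lemma env_mult_scale: "x * escale r y = escale r (x * y)"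
  by transfer (simp add: fmul_scale_right env_rel_def env_ideal.zero)

end

lemma env_mult_zero: "x * 0 = (0 :: 'k::field env_alg)" "0 * x = (0 :: 'k env_alg)"
  using env_mult_diff[of x 0 0] env_diff_mult[of 0 0 x] by simp_all

lemma env_mult_add: "x * (y + z) = x * y + x * (z :: 'k::field env_alg)"
  using env_mult_diff[of x y "0 - z"] env_mult_diff[of x 0 z] by (simp add: env_mult_zero)

lemma env_add_mult: "(x + y) * z = x * z + y * (z :: 'k::field env_alg)"
  using env_diff_mult[of x "0 - y" z] env_diff_mult[of 0 y z] by (simp add: env_mult_zero)

lemma femb_indicator: "femb (\<lambda>x. if x = f then 1 else 0) = Poly_Mapping.single (Some (Leaf f)) 1"
  by (cases f) (simp_all add: femb_def UNIV_gen)

lemma bracket_indicator: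
  "bracket (\<lambda>x. if x = f then 1 else 0) (\<lambda>x. if x = g then 1 else 0) = basis_bracket f g"
  by (cases f; cases g) (simp_all add: bracket_def UNIV_gen fun_eq_iff)

lemma egen_commutator:
  "egen f * egen g - egen g * egen f
    = (\<Sum>h\<in>UNIV. escale (basis_bracket f g h) (egen h :: 'k::field env_alg))"
proof -
  have femb: "femb v = scale (v Ga) (Poly_Mapping.single (Some (Leaf Ga)) 1)
      + (scale (v Gb) (Poly_Mapping.single (Some (Leaf Gb)) 1)
      + (scale (v Gc) (Poly_Mapping.single (Some (Leaf Gc)) 1)
      + (scale (v Gd) (Poly_Mapping.single (Some (Leaf Gd)) 1)
      + scale (v Ge) (Poly_Mapping.single (Some (Leaf Ge)) 1))))" for v :: "gen \<Rightarrow> 'k"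
    by (simp add: femb_def UNIV_gen scale_single)
  have "egen f * egen g - egen g * egen f = escale (basis_bracket f g Ga) (egen Ga :: 'k env_alg)
      + (escale (basis_bracket f g Gb) (egen Gb)
      + (escale (basis_bracket f g Gc) (egen Gc)
      + (escale (basis_bracket f g Gd) (egen Gd)
      + escale (basis_bracket f g Ge) (egen Ge))))"
  proof transfer
    fix f g
    show "env_rel
      (fmul (Poly_Mapping.single (Some (Leaf f)) 1) (Poly_Mapping.single (Some (Leaf g)) 1)
       - fmul (Poly_Mapping.single (Some (Leaf g)) 1) (Poly_Mapping.single (Some (Leaf f)) 1))
      (scale (basis_bracket f g Ga) (Poly_Mapping.single (Some (Leaf Ga)) (1::'k))
      + (scale (basis_bracket f g Gb) (Poly_Mapping.single (Some (Leaf Gb)) 1)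
      + (scale (basis_bracket f g Gc) (Poly_Mapping.single (Some (Leaf Gc)) 1)
      + (scale (basis_bracket f g Gd) (Poly_Mapping.single (Some (Leaf Gd)) 1)
      + scale (basis_bracket f g Ge) (Poly_Mapping.single (Some (Leaf Ge)) 1)))))"
      using env_ideal.commutator[of "\<lambda>x. if x = f then 1 else (0::'k)" "\<lambda>x. if x = g then 1 else 0"]
      unfolding femb_indicator bracket_indicator femb env_rel_def .
  qed
  then show ?thesis by (simp add: UNIV_gen)
qed

definition env_assoc :: "'k::field env_alg \<Rightarrow> 'k env_alg \<Rightarrow> 'k env_alg \<Rightarrow> 'k env_alg" where
  "env_assoc x y z = (x * y) * z - x * (y * z)"

lemma env_assoc_left: "env_assoc (egen f) x y = - env_assoc x (egen f) y"
proof -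
  have "env_assoc (egen f) x y + env_assoc x (egen f) y = 0"
    unfolding env_assoc_def
  proof transfer
    fix f and x y :: "'a free_alg"
    show "env_rel (fmul (fmul (Poly_Mapping.single (Some (Leaf f)) 1) x) y -
        fmul (Poly_Mapping.single (Some (Leaf f)) 1) (fmul x y) +
        (fmul (fmul x (Poly_Mapping.single (Some (Leaf f)) 1)) y -
        fmul x (fmul (Poly_Mapping.single (Some (Leaf f)) 1) y))) 0"
      using env_ideal.nucleus_left[of "\<lambda>x. if x = f then 1 else 0" x y]
      by (simp only: femb_indicator fassoc_def env_rel_def diff_zero)
  qed
  then show ?thesis by (simp add: eq_neg_iff_add_eq_0)
qed

lemma env_assoc_right: "env_assoc x (egen f) y = - env_assoc x y (egen f)"
proof -
  have "env_assoc x (egen f) y + env_assoc x y (egen f) = 0"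
    unfolding env_assoc_def
  proof transfer
    fix f and x y :: "'a free_alg"
    show "env_rel (fmul (fmul x (Poly_Mapping.single (Some (Leaf f)) 1)) y -
        fmul x (fmul (Poly_Mapping.single (Some (Leaf f)) 1) y) +
        (fmul (fmul x y) (Poly_Mapping.single (Some (Leaf f)) 1) -
        fmul x (fmul y (Poly_Mapping.single (Some (Leaf f)) 1)))) 0"
      using env_ideal.nucleus_right[of x "\<lambda>x. if x = f then 1 else 0" y]
      by (simp only: femb_indicator fassoc_def env_rel_def diff_zero)
  qed
  then show ?thesis by (simp add: eq_neg_iff_add_eq_0)
qed

abbreviation commutator :: "'k::field env_alg \<Rightarrow> 'k env_alg \<Rightarrow> 'k env_alg" where
  "commutator x y \<equiv> x * y - y * x"

lemma
  fixes x :: "'k::field env_alg" and f g :: gen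
  defines "F \<equiv> egen f" and "G \<equiv> egen g"
  shows env_commutator_mult: "commutator (F * x) G =
      commutator F G * x + F * commutator x G - escale 3 (env_assoc x F G)"
    and env_mult_mult: "G * (F * x) =
      F * (G * x) - commutator F G * x + escale 2 (env_assoc x F G)"
    and env_commutator_commutator: "commutator (commutator x F) G - commutator (commutator x G) F
      - commutator x (commutator F G) = escale 6 (env_assoc x F G)"
proof -
  define A where "A = env_assoc x F G"
  have assocs: "env_assoc x F G = A" "env_assoc F x G = - A" "env_assoc F G x = A"
    "env_assoc G F x = - A" "env_assoc G x F = A" "env_assoc x G F = - A"
    using env_assoc_left[of f x G] env_assoc_right[of x f G] env_assoc_left[of f G x]
      env_assoc_right[of G f x] env_assoc_left[of g x F]
    unfolding A_def F_def G_def by simp_all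
  have split: "(u * v) * w = u * (v * w) + env_assoc u v w" for u v w :: "'k env_alg"
    by (simp add: env_assoc_def)
  have rearrange: "(x * F) * G = x * (F * G) + A" "(F * x) * G = F * (x * G) - A"
    "(F * G) * x = F * (G * x) + A" "(G * F) * x = G * (F * x) - A"
    "(G * x) * F = G * (x * F) + A" "(x * G) * F = x * (G * F) - A"
    unfolding split assocs by simp_all
  have "2 = (1 + 1 :: 'k)" "3 = (1 + 1 + 1 :: 'k)" "6 = (1 + 1 + 1 + 1 + 1 + 1 :: 'k)"
    by simp_all
  then have "escale 2 A = A + A" "escale 3 A = A + A + A" "escale 6 A = A + A + A + A + A + A"
    by (simp_all only: env.scale_left_distrib env.scale_one)
  note expand = env_diff_mult env_mult_diff rearrange A_def[symmetric] this
  show "commutator (F * x) G =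
      commutator F G * x + F * commutator x G - escale 3 (env_assoc x F G)"
    by (simp add: expand)
  show "G * (F * x) = F * (G * x) - commutator F G * x + escale 2 (env_assoc x F G)"
    by (simp add: expand)
  show "commutator (commutator x F) G - commutator (commutator x G) F
      - commutator x (commutator F G) = escale 6 (env_assoc x F G)"
    by (simp add: expand)
qed

lemma left_tapped_Cons: "left_tapped (x # xs) = egen x * left_tapped xs"
  by (cases xs) (simp_all add: env_one_right)

lemma prod_list_pvar:
  "prod_list (map pvar xs) =
    (Poly_Mapping.single (\<Sum>x\<leftarrow>xs. Poly_Mapping.single x 1) 1 :: 'k::field pol)"
  by (induction xs) (simp_all add: pvar_def mult_single)

lemma obtain_sorted_list:
  fixes m :: "gen \<Rightarrow>\<^sub>0 nat"
  obtains xs where "sorted xs" "(\<Sum>x\<leftarrow>xs. Poly_Mapping.single x 1) = m"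
    "\<And>f. m \<in> monos_ge f \<Longrightarrow> \<forall>x\<in>set xs. f \<le> x"
proof -
  have "\<exists>xs. sorted xs \<and> (\<Sum>x\<leftarrow>xs. Poly_Mapping.single x 1) = m \<and>
      (\<forall>f. m \<in> monos_ge f \<longrightarrow> (\<forall>x\<in>set xs. f \<le> x))"
  proof (induction "mdeg m" arbitrary: m rule: less_induct)
    case less
    show ?case
    proof (cases m rule: mono_cases)
      case 1
      then show ?thesis by (intro exI[of _ "[]"]) simp
    next
      case (2 f m')
      then have "mdeg m' < mdeg m" by (simp only: mdeg_single_plus)
      from less[OF this] obtain xs where xs: "sorted xs" "(\<Sum>x\<leftarrow>xs. Poly_Mapping.single x 1) = m'"
        "\<forall>f. m' \<in> monos_ge f \<longrightarrow> (\<forall>x\<in>set xs. f \<le> x)" by blast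
      have "sorted (f # xs)" using xs(1,3) 2(2) by simp
      moreover have "(\<Sum>x\<leftarrow>f # xs. Poly_Mapping.single x 1) = m"
        using xs(2) 2(1) by simp
      moreover have "\<forall>g. m \<in> monos_ge g \<longrightarrow> (\<forall>x\<in>set (f # xs). g \<le> x)"
        unfolding 2(1) monos_ge_single_plus using xs(3) by simp
      ultimately show ?thesis by blast
    qed
  qed
  then show ?thesis using that by blast
qed

theorem proposition3p7:
  fixes \<phi> :: "'k::field env_alg \<Rightarrow> 'k pol"
  assumes "CHAR('k) \<noteq> 2" and "CHAR('k) \<noteq> 3"
    and "is_pbw_iso \<phi>"
  shows
    "rho \<phi> (egen Ga) = (\<lambda>f. - mulop Gc (dop Gb f) + scale (1/2) (mulop Ge (dop Gb (dop Gd f)))) \<and>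
     rho \<phi> (egen Gb) = (\<lambda>f. mulop Gc (dop Ga f) - scale (1/2) (mulop Ge (dop Ga (dop Gd f)))) \<and>
     rho \<phi> (egen Gc) = (\<lambda>f. - mulop Ge (dop Gd f)) \<and>
     rho \<phi> (egen Gd) = (\<lambda>f. mulop Ge (dop Gc f) + scale (1/2) (mulop Ge (dop Ga (dop Gb f)))) \<and>
     rho \<phi> (egen Ge) = (\<lambda>f. 0) \<and>
     lmul \<phi> (egen Ga) = (\<lambda>f. mulop Ga f) \<and>
     lmul \<phi> (egen Gb) = (\<lambda>f. mulop Gb f - mulop Gc (dop Ga f) + scale (1/3) (mulop Ge (dop Ga (dop Gd f)))) \<and>
     lmul \<phi> (egen Gc) = (\<lambda>f. mulop Gc f) \<and>
     lmul \<phi> (egen Gd) = (\<lambda>f. mulop Gd f - mulop Ge (dop Gc f) - scale (1/3) (mulop Ge (dop Ga (dop Gb f)))) \<and>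
     lmul \<phi> (egen Ge) = (\<lambda>f. mulop Ge f)"
proof -
  have "\<not> CHAR('k) dvd 2"
    using assms(1) dvd_imp_le[of "CHAR('k)" 2] by (auto simp: le_Suc_eq numeral_2_eq_2)
  moreover have "\<not> CHAR('k) dvd 3"
    using assms(2) dvd_imp_le[of "CHAR('k)" 3] by (auto simp: le_Suc_eq numeral_3_eq_3)
  ultimately have "(2::'k) \<noteq> 0" "(3::'k) \<noteq> 0"
    using of_nat_eq_0_iff_char_dvd[of 2, where 'a = 'k] of_nat_eq_0_iff_char_dvd[of 3, where 'a = 'k]
    by simp_all
  interpret phi: Vector_Spaces.linear escale scale \<phi>
    using assms(3) by (simp add: is_pbw_iso_def)
  define \<psi> where "\<psi> = inv \<phi>"
  have "bij \<phi>" using assms(3) by (simp add: is_pbw_iso_def)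
  then have phi_psi [simp]: "\<phi> (\<psi> p) = p" and psi_phi [simp]: "\<psi> (\<phi> x) = x" for p x
    by (simp_all add: \<psi>_def bij_is_surj surj_f_inv_f bij_is_inj)
  have psi_add: "\<psi> (p + q) = \<psi> p + \<psi> q" for p q
    by (metis phi.add phi_psi psi_phi)
  have psi_scale: "\<psi> (scale r p) = escale r (\<psi> p)" for r p
    by (metis phi.scale phi_psi psi_phi)
  define R where "R g = rho \<phi> (egen g)" for g
  define L where "L g = lmul \<phi> (egen g)" for g
  have R: "R g p = \<phi> (commutator (\<psi> p) (egen g))" and L: "L g p = \<phi> (egen g * \<psi> p)" for g p
    by (simp_all add: R_def L_def rho_def lmul_def \<psi>_def)
  have phi_tapped: "\<phi> (left_tapped xs) = prod_list (map pvar xs)" if "sorted xs" for xs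
    using assms(3) that by (simp add: is_pbw_iso_def)
  have br_R: "bracket_op R f g p = \<phi> (commutator (\<psi> p) (commutator (egen f) (egen g)))" for f g p
    unfolding egen_commutator bracket_op_def R
    by (simp add: UNIV_gen env_mult_add env_add_mult env_scale_mult env_mult_scale
        phi.add phi.diff phi.scale pol.scale_right_diff_distrib)
  have br_L: "bracket_op L f g p = \<phi> (commutator (egen f) (egen g) * \<psi> p)" for f g p
    unfolding egen_commutator bracket_op_def L
    by (simp add: UNIV_gen env_add_mult env_scale_mult phi.add phi.scale)
  have assoc_R: "sixfold_associator_op R f g p = \<phi> (escale 6 (env_assoc (\<psi> p) (egen f) (egen g)))" for f g p
    unfolding env_commutator_commutator[symmetric] sixfold_associator_op_def br_R
    unfolding R psi_phi by (simp only: phi.diff)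
  have "R g p = rop g p \<and> L g p = lop g p" for g p
  proof (rule operators_determined)
    fix f g :: gen and p :: "'k pol"
    show "Vector_Spaces.linear scale scale (R g)"
      by (simp add: Vector_Spaces.linear_iff vector_space_scale R psi_add psi_scale env_add_mult
          env_mult_add env_scale_mult env_mult_scale phi.add phi.diff phi.scale
          pol.scale_right_diff_distrib)
    show "Vector_Spaces.linear scale scale (L g)"
      by (simp add: Vector_Spaces.linear_iff vector_space_scale L psi_add psi_scale
          env_mult_add env_mult_scale phi.add phi.scale)
    have "scale (1/2) (sixfold_associator_op R f g p) = \<phi> (escale 3 (env_assoc (\<psi> p) (egen f) (egen g)))"
      using \<open>2 \<noteq> 0\<close> unfolding assoc_R phi.scale by (simp add: field_simps)
    then show "R g (L f p) =
        bracket_op L f g p + L f (R g p) - scale (1/2) (sixfold_associator_op R f g p)"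
      unfolding br_L R L psi_phi by (simp only: env_commutator_mult phi.diff phi.add)
    have "scale (1/3) (sixfold_associator_op R f g p) = \<phi> (escale 2 (env_assoc (\<psi> p) (egen f) (egen g)))"
      using \<open>3 \<noteq> 0\<close> unfolding assoc_R phi.scale by (simp add: field_simps)
    then show "L g (L f p) =
        L f (L g p) - bracket_op L f g p + scale (1/3) (sixfold_associator_op R f g p)"
      unfolding br_L R L psi_phi by (simp only: env_mult_mult[where f = f and g = g] phi.diff phi.add)
    have "\<psi> 1 = 1"
      using phi_tapped[of "[]"] psi_phi[of 1] by simp
    then show "R g 1 = 0"
      by (simp add: R env_one_left env_one_right)
  next
    fix g and m :: "gen \<Rightarrow>\<^sub>0 nat"
    assume "m \<in> monos_ge g"
    then obtain xs where xs: "sorted (g # xs)" "(\<Sum>x\<leftarrow>xs. Poly_Mapping.single x 1) = m"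
      using obtain_sorted_list[of m] by (metis sorted_simps(2))
    then have "Poly_Mapping.single m 1 = \<phi> (left_tapped xs)"
      by (simp add: phi_tapped prod_list_pvar)
    then have "L g (Poly_Mapping.single m 1) = \<phi> (left_tapped (g # xs))"
      by (simp add: L left_tapped_Cons)
    also have "\<dots> = mulop g (Poly_Mapping.single m 1)"
      using xs by (simp only: phi_tapped list.map prod_list.Cons mulop_def prod_list_pvar)
    finally show "L g (Poly_Mapping.single m 1) = mulop g (Poly_Mapping.single m 1)" .
  qed
  then show ?thesis
    unfolding R_def L_def by (simp add: fun_eq_iff)
qed

end
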